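(* Assume that the price function $P$ is Lipschitz continuous. Then there exists a unique solution $(X,u)$ on $[0,T]$ to the forward-backward system $$\dot X_t=-\delta X_t+\frac1\beta (u_t-\alpha)^+,\qquad \dot u_t=(r+\delta)u_t-\big(P(X_t)-c\big)h,\qquad t\in[0,T],$$ with initial condition $X_0\ge 0$ given for $X$ and terminal condition $u_T=0$ for $u$.
   Context: Constants: $T>0$, $\delta>0$, $r>0$, $\alpha>0$, $\beta>0$, $c>0$, $h\in[0,8760]$, and a given initial value $X_0\ge 0$. The price function $P:[0,\infty)\to\mathbb{R}$ is strictly decreasing. Notation: $y^+=\max(y,0)$. A solution is a pair of continuously differentiable functions $X:[0,T]\to[0,\infty)$, $u:[0,T]\to\mathbb{R}$ satisfying both equations on $[0,T]$ and the stated boundary conditions. *)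

theory Defs
  imports "HOL-Analysis.Analysis"
begin

(* The library's C1_differentiable_on asks for two-sided derivatives at every point of the set;
   here the derivative at an endpoint of the interval is one-sided. *)
definition C1_on_interval :: "real \<Rightarrow> real \<Rightarrow> (real \<Rightarrow> real) \<Rightarrow> bool" where
  "C1_on_interval a b f \<longleftrightarrow>
     (\<exists>f'. continuous_on {a..b} f' \<and>
           (\<forall>t\<in>{a..b}. (f has_real_derivative f' t) (at t within {a..b})))"

(* X and u are total functions, of which only the values on {0..T} matter. *)
definition fb_solution ::
    "real \<Rightarrow> real \<Rightarrow> real \<Rightarrow> real \<Rightarrow> real \<Rightarrow> real \<Rightarrow> real \<Rightarrow> (real \<Rightarrow> real) \<Rightarrow> real
      \<Rightarrow> (real \<Rightarrow> real) \<Rightarrow> (real \<Rightarrow> real) \<Rightarrow> bool" where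
  "fb_solution T \<delta> r \<alpha> \<beta> c h P X0 X u \<longleftrightarrow>
     C1_on_interval 0 T X \<and> C1_on_interval 0 T u \<and>
     (\<forall>t\<in>{0..T}. 0 \<le> X t) \<and>
     (\<forall>t\<in>{0..T}. (X has_real_derivative (- \<delta> * X t + 1 / \<beta> * max (u t - \<alpha>) 0))
                    (at t within {0..T})) \<and>
     (\<forall>t\<in>{0..T}. (u has_real_derivative ((r + \<delta>) * u t - (P (X t) - c) * h))
                    (at t within {0..T})) \<and>
     X 0 = X0 \<and> u T = 0"

end

theory Submission
  imports Defs
begin

text \<open>
  The proof is a shooting argument. Write the system as
  \<open>X' = g u - \<delta> X\<close>, \<open>u' = \<rho> u + q X\<close> with \<open>\<rho> = r + \<delta>\<close>, where \<open>g u\<close> is the investment term and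
  \<open>q X = - (P X - c) h\<close>. Both \<open>g\<close> and \<open>q\<close> are nondecreasing and Lipschitz, the latter after \<open>P\<close> is
  continued to the left of \<open>0\<close> by the constant \<open>P 0\<close>; since \<open>g \<ge> 0\<close>, solutions starting at
  \<open>X0 \<ge> 0\<close> stay nonnegative, so the continuation is never seen. For every \<open>s\<close>, the initial value
  problem with \<open>X 0 = X0\<close> and \<open>u 0 = s\<close> then has a solution on \<open>{0..T}\<close>, and the question is
  whether exactly one \<open>s\<close> leads to \<open>u T = 0\<close>.

  The answer comes from monotonicity. For two solutions \<open>(X, u)\<close> and \<open>(Y, v)\<close> with the same initial
  value of the first component, the product \<open>p = (X - Y) (u - v)\<close> satisfies \<open>p' \<ge> (\<rho> - \<delta>) p\<close>,
  because \<open>(g u - g v) (u - v)\<close> and \<open>(q X - q Y) (X - Y)\<close> are nonnegative. Since \<open>p 0 = 0\<close>, this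
  gives \<open>p \<ge> 0\<close> throughout: the two gaps never have opposite signs. Hence
  \<open>(q X - q Y) (u - v) \<ge> 0\<close>, and so \<open>\<bar>u - v\<bar>\<close> is nondecreasing in time
  (\<open>cooperative_gap_nondecreasing\<close>). Two consequences follow.

  \<^item> If \<open>u T = v T\<close>, then \<open>u = v\<close> on the whole interval, and \<open>X - Y\<close> solves a homogeneous linear
    equation with initial value \<open>0\<close>. This is uniqueness (\<open>cooperative_boundary_unique\<close>).
  \<^item> The shooting map, which takes \<open>s\<close> to the terminal value of \<open>u\<close>, increases with slope at least
    \<open>1\<close>. It is also continuous, by the Lipschitz dependence of solutions on initial values,
    so it takes every real value. This is existence (\<open>cooperative_boundary_exists\<close>).
\<close>

section \<open>Lipschitz initial value problems\<close>

text \<open>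
  The derivative of \<open>f \<tau> * exp (k * (t - \<tau>))\<close> in \<open>\<tau>\<close> is nonnegative. With \<open>k = 0\<close> the lemma is a monotonicity criterion, and applied to
  \<open>- f\<close> it gives the upper bounds of Gronwall type.
\<close>

lemma exponential_growth:
  fixes f f' :: "real \<Rightarrow> real"
  assumes deriv: "\<And>t. t \<in> {a..b} \<Longrightarrow> (f has_real_derivative f' t) (at t within {a..b})"
    and growth: "\<And>t. t \<in> {a..b} \<Longrightarrow> k * f t \<le> f' t"
    and "a \<le> s" "s \<le> t" "t \<le> b"
  shows "f s * exp (k * (t - s)) \<le> f t"
proof -
  define g where "g \<equiv> \<lambda>\<tau>. f \<tau> * exp (k * (t - \<tau>))"
  have dg: "(g has_real_derivative (f' \<tau> - k * f \<tau>) * exp (k * (t - \<tau>))) (at \<tau> within {a..b})"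
    if "\<tau> \<in> {a..b}" for \<tau>
    unfolding g_def
    by (rule derivative_eq_intros deriv that | simp add: algebra_simps)+
  have "g s \<le> g t"
  proof (rule DERIV_nonneg_imp_increasing_open[of s t g])
    fix x assume "s < x" "x < t"
    then show "\<exists>y. (g has_real_derivative y) (at x) \<and> 0 \<le> y"
      using assms dg[of x] growth[of x]
      by (intro exI[of _ "(f' x - k * f x) * exp (k * (t - x))"])
         (auto simp: at_within_Icc_at)
  next
    have "continuous_on {a..b} g"
      using dg by (meson DERIV_continuous continuous_on_eq_continuous_within)
    then show "continuous_on {s..t} g"
      by (rule continuous_on_subset) (use assms in auto)
  qed fact
  then show ?thesis by (simp add: g_def)
qed

text \<open>
  The integral equation is solved by Banach's fixed point theorem in the space of bounded continuous
  functions. The unknown is rescaled to \<open>z t = exp (- K * t) *\<^sub>R y t\<close> with \<open>K > L\<close>; in this weighted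
  form the Picard operator contracts by the factor \<open>L / K\<close> whatever the length of the interval, so no
  gluing of short-time solutions is necessary.
\<close>

lemma global_picard_lindelof:
  fixes F :: "'a::banach \<Rightarrow> 'a"
  assumes lip: "L-lipschitz_on UNIV F" and T: "0 \<le> T"
  obtains y where "y 0 = y0"
    and "\<And>t. t \<in> {0..T} \<Longrightarrow> (y has_vector_derivative F (y t)) (at t within {0..T})"
proof -
  define K where "K = L + 1"
  have L: "0 \<le> L" using lip by (rule lipschitz_on_nonneg)
  then have K: "0 < K" "L < K" by (auto simp: K_def)
  have contF: "continuous_on UNIV F" using lip by (rule lipschitz_on_continuous_on)
  \<comment> \<open>Bounded continuous functions live on all of \<open>\<real>\<close>; retracting time to \<open>{0..T}\<close> makes
      the values of the Picard operator bounded.\<close>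
  define cl :: "real \<Rightarrow> real" where "cl t = max 0 (min t T)" for t
  have cl: "cl t \<in> {0..T}" for t using T by (auto simp: cl_def)
  have cl_id: "cl t = t" if "t \<in> {0..T}" for t using that by (auto simp: cl_def)
  have cont_cl: "continuous_on UNIV cl"
    unfolding cl_def by (intro continuous_intros)
  define f where "f z s = F (exp (K * s) *\<^sub>R apply_bcontfun z s)" for z :: "real \<Rightarrow>\<^sub>C 'a" and s
  have cont_f: "continuous_on A (f z)" for z A
    unfolding f_def
    by (intro continuous_on_compose2[OF contF] continuous_intros
        continuous_on_apply_bcontfun) auto
  define J where "J z t = exp (- K * t) *\<^sub>R (y0 + integral {0..t} (f z))" for z t
  have cont_J: "continuous_on {0..T} (J z)" for z
    unfolding J_def
    by (intro continuous_intros indefinite_integral_continuous_1 integrable_continuous_interval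
        cont_f)
  define \<Phi> where "\<Phi> z = Bcontfun (\<lambda>t. J z (cl t))" for z
  have in_bcontfun: "(\<lambda>t. J z (cl t)) \<in> bcontfun" for z
  proof -
    have "compact (J z ` {0..T})"
      by (intro compact_continuous_image cont_J compact_Icc)
    then obtain B where "\<And>x. x \<in> J z ` {0..T} \<Longrightarrow> norm x \<le> B"
      using compact_imp_bounded bounded_iff by metis
    then have "norm (J z (cl t)) \<le> B" for t
      using cl by blast
    moreover have "continuous_on UNIV (\<lambda>t. J z (cl t))"
      by (rule continuous_on_compose2[OF cont_J cont_cl]) (use cl in auto)
    ultimately show ?thesis by (intro bcontfun_normI)
  qed
  have \<Phi>: "apply_bcontfun (\<Phi> z) t = J z (cl t)" for z t
    unfolding \<Phi>_def by (simp add: Bcontfun_inverse in_bcontfun)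
  have contraction: "dist (\<Phi> z) (\<Phi> w) \<le> L / K * dist z w" for z w
  proof (rule dist_bound)
    fix t0
    define t where "t = cl t0"
    have t: "0 \<le> t" using cl[of t0] by (simp add: t_def)
    have int: "f z integrable_on {0..t}" for z
      by (intro integrable_continuous_interval cont_f)
    have pointwise: "norm (f z s - f w s) \<le> L * dist z w * exp (K * s)" for s
    proof -
      have "norm (f z s - f w s) \<le> L * dist (exp (K * s) *\<^sub>R z s) (exp (K * s) *\<^sub>R w s)"
        using lipschitz_onD[OF lip, of "exp (K * s) *\<^sub>R z s" "exp (K * s) *\<^sub>R w s"]
        by (simp add: f_def dist_norm)
      also have "\<dots> = L * (exp (K * s) * dist (z s) (w s))"
        by (simp add: dist_norm flip: scaleR_diff_right)
      also have "\<dots> \<le> L * (exp (K * s) * dist z w)"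
        by (intro mult_left_mono dist_bounded L) auto
      finally show ?thesis by (simp add: mult_ac)
    qed
    have exp_int: "((\<lambda>s. L * dist z w * exp (K * s)) has_integral
        L * dist z w * exp (K * t) / K - L * dist z w * exp (K * 0) / K) {0..t}"
      using K by (intro fundamental_theorem_of_calculus t)
         (auto intro!: derivative_eq_intros simp flip: has_real_derivative_iff_has_vector_derivative)
    have "dist (\<Phi> z t0) (\<Phi> w t0) = exp (- K * t) * norm (integral {0..t} (\<lambda>s. f z s - f w s))"
      unfolding \<Phi> J_def t_def[symmetric] using int
      by (simp add: dist_norm integral_diff flip: scaleR_diff_right)
    also have "\<dots> \<le> exp (- K * t) * integral {0..t} (\<lambda>s. L * dist z w * exp (K * s))"
      using pointwise exp_int
      by (intro mult_left_mono integral_norm_bound_integral integrable_diff int) auto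
    also have "\<dots> = exp (- K * t) * (L * dist z w * exp (K * t) / K - L * dist z w / K)"
      using integral_unique[OF exp_int] by simp
    also have "\<dots> \<le> exp (- K * t) * (L * dist z w * exp (K * t) / K)"
      using L K by (intro mult_left_mono) auto
    also have "\<dots> = L / K * dist z w"
      by (simp add: exp_minus field_simps)
    finally show "dist (\<Phi> z t0) (\<Phi> w t0) \<le> L / K * dist z w" .
  qed
  have "\<exists>!z. \<Phi> z = z"
    using contraction L K by (intro banach_fix_type[of "L / K"]) auto
  then obtain z where z: "\<Phi> z = z" by blast
  define y where "y t = exp (K * t) *\<^sub>R apply_bcontfun z t" for t
  have fy: "f z s = F (y s)" for s by (simp add: f_def y_def)
  have y: "y t = y0 + integral {0..t} (\<lambda>s. F (y s))" if "t \<in> {0..T}" for t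
  proof -
    have "z t = J z t" using \<Phi>[of z t] z cl_id[OF that] by simp
    then show ?thesis unfolding y_def[of t] J_def fy by (simp flip: exp_add)
  qed
  have "(y has_vector_derivative F (y t)) (at t within {0..T})" if t: "t \<in> {0..T}" for t
  proof -
    have "((\<lambda>t. y0 + integral {0..t} (\<lambda>s. F (y s))) has_vector_derivative F (y t))
        (at t within {0..T})"
      using cont_f[of "{0..T}" z] t
      by (auto intro!: derivative_eq_intros integral_has_vector_derivative simp: fy[abs_def])
    then show ?thesis
      by (rule has_vector_derivative_transform[OF t, rotated]) (use y in auto)
  qed
  moreover have "y 0 = y0" using y[of 0] T by simp
  ultimately show ?thesis using that by blast
qed

text \<open>
  By the Cauchy-Schwarz inequality and the Lipschitz bound, the squared distance of two solutions
  grows at most at the rate \<open>2 * L\<close>.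
\<close>

lemma lipschitz_dependence_on_initial_value:
  fixes F :: "'a::real_inner \<Rightarrow> 'a"
  assumes lip: "L-lipschitz_on UNIV F" and T: "0 \<le> T"
    and y: "\<And>t. t \<in> {0..T} \<Longrightarrow> (y has_vector_derivative F (y t)) (at t within {0..T})"
    and z: "\<And>t. t \<in> {0..T} \<Longrightarrow> (z has_vector_derivative F (z t)) (at t within {0..T})"
  shows "norm (y T - z T) \<le> exp (L * T) * norm (y 0 - z 0)"
proof -
  define d where "d t = y t - z t" for t
  define d' where "d' t = F (y t) - F (z t)" for t
  have d: "(d has_vector_derivative d' t) (at t within {0..T})" if "t \<in> {0..T}" for t
    unfolding d_def d'_def by (intro has_vector_derivative_diff y z that)
  have energy: "((\<lambda>t. - (d t \<bullet> d t)) has_real_derivative - (2 * (d t \<bullet> d' t))) (at t within {0..T})"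
    if "t \<in> {0..T}" for t
    using has_vector_derivative_minus[OF bounded_bilinear.has_vector_derivative[OF
          bounded_bilinear_inner d[OF that] d[OF that]]]
    by (simp add: has_real_derivative_iff_has_vector_derivative inner_commute)
  have bound: "2 * L * - (d t \<bullet> d t) \<le> - (2 * (d t \<bullet> d' t))" for t
  proof -
    have "d t \<bullet> d' t \<le> norm (d t) * norm (d' t)" by (rule norm_cauchy_schwarz)
    also have "\<dots> \<le> norm (d t) * (L * norm (d t))"
      using lipschitz_onD[OF lip, of "y t" "z t"]
      by (intro mult_left_mono) (auto simp: d_def d'_def dist_norm)
    also have "\<dots> = L * (d t \<bullet> d t)"
      by (simp add: dot_square_norm power2_eq_square)
    finally show ?thesis by simp
  qed
  have "- (d 0 \<bullet> d 0) * exp (2 * L * (T - 0)) \<le> - (d T \<bullet> d T)"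
    by (rule exponential_growth[OF energy bound]) (use T in auto)
  also have "exp (2 * L * (T - 0)) = (exp (L * T))\<^sup>2"
    by (simp add: mult_ac flip: exp_double)
  finally have "(norm (d T))\<^sup>2 \<le> (exp (L * T) * norm (d 0))\<^sup>2"
    by (simp add: dot_square_norm power_mult_distrib mult_ac)
  then show ?thesis
    unfolding d_def by (rule power2_le_imp_le) simp
qed

section \<open>Comparison of two solutions\<close>

definition cooperative_solution ::
    "real \<Rightarrow> real \<Rightarrow> real \<Rightarrow> (real \<Rightarrow> real) \<Rightarrow> (real \<Rightarrow> real) \<Rightarrow> (real \<Rightarrow> real) \<Rightarrow> (real \<Rightarrow> real) \<Rightarrow> bool"
  where
  "cooperative_solution T \<delta> \<rho> g q X u \<longleftrightarrow>
     (\<forall>t\<in>{0..T}. (X has_real_derivative g (u t) - \<delta> * X t) (at t within {0..T})) \<and>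
     (\<forall>t\<in>{0..T}. (u has_real_derivative \<rho> * u t + q (X t)) (at t within {0..T}))"

lemma mono_diff_mult_nonneg:
  fixes g :: "real \<Rightarrow> real"
  assumes "mono g" "0 \<le> (x - y) * w"
  shows "0 \<le> (g x - g y) * w"
  using assms monoD[OF assms(1), of x y] monoD[OF assms(1), of y x]
  by (cases x y rule: linorder_cases) (auto simp: zero_le_mult_iff)

text \<open>
  The key estimate. The product of the two gaps vanishes initially and cannot become negative, so
  the feedback \<open>q X - q Y\<close> never has the sign opposite to \<open>u - v\<close> and can only drive \<open>u\<close> and \<open>v\<close>
  further apart.
\<close>

lemma cooperative_gap_nondecreasing:
  assumes sol1: "cooperative_solution T \<delta> \<rho> g q X u"
    and sol2: "cooperative_solution T \<delta> \<rho> g q Y v"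
    and g: "mono g" and q: "mono q" and \<rho>: "0 \<le> \<rho>"
    and init: "X 0 = Y 0"
    and st: "0 \<le> s" "s \<le> t" "t \<le> T"
  shows "\<bar>u s - v s\<bar> \<le> \<bar>u t - v t\<bar>"
proof -
  note D = sol1[unfolded cooperative_solution_def] sol2[unfolded cooperative_solution_def]
  define p where "p t = (X t - Y t) * (u t - v t)" for t
  define p' where "p' t = (g (u t) - \<delta> * X t - (g (v t) - \<delta> * Y t)) * (u t - v t)
      + (\<rho> * u t + q (X t) - (\<rho> * v t + q (Y t))) * (X t - Y t)" for t
  have dp: "(p has_real_derivative p' \<tau>) (at \<tau> within {0..T})" if "\<tau> \<in> {0..T}" for \<tau>
    unfolding p_def p'_def using D that by (auto intro!: derivative_eq_intros)
  have p': "(\<rho> - \<delta>) * p \<tau> \<le> p' \<tau>" for \<tau>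
  proof -
    have "0 \<le> (g (u \<tau>) - g (v \<tau>)) * (u \<tau> - v \<tau>)"
      using mono_diff_mult_nonneg[OF g, of "u \<tau>" "v \<tau>" "u \<tau> - v \<tau>"] by simp
    moreover have "0 \<le> (q (X \<tau>) - q (Y \<tau>)) * (X \<tau> - Y \<tau>)"
      using mono_diff_mult_nonneg[OF q, of "X \<tau>" "Y \<tau>" "X \<tau> - Y \<tau>"] by simp
    ultimately show ?thesis by (simp add: p_def p'_def algebra_simps)
  qed
  have p: "0 \<le> p \<tau>" if "\<tau> \<in> {0..T}" for \<tau>
    using exponential_growth[OF dp p', of 0 \<tau>] that init by (simp add: p_def)
  define e' where "e' \<tau> = 2 * (\<rho> * u \<tau> + q (X \<tau>) - (\<rho> * v \<tau> + q (Y \<tau>))) * (u \<tau> - v \<tau>)" for \<tau>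
  have de: "((\<lambda>\<tau>. (u \<tau> - v \<tau>)\<^sup>2) has_real_derivative e' \<tau>) (at \<tau> within {0..T})"
    if "\<tau> \<in> {0..T}" for \<tau>
    unfolding e'_def using D that by (auto intro!: derivative_eq_intros)
  have e': "0 * (u \<tau> - v \<tau>)\<^sup>2 \<le> e' \<tau>" if "\<tau> \<in> {0..T}" for \<tau>
  proof -
    have "0 \<le> (q (X \<tau>) - q (Y \<tau>)) * (u \<tau> - v \<tau>)"
      using mono_diff_mult_nonneg[OF q p[OF that, unfolded p_def]] .
    moreover have "e' \<tau> = 2 * (\<rho> * (u \<tau> - v \<tau>)\<^sup>2 + (q (X \<tau>) - q (Y \<tau>)) * (u \<tau> - v \<tau>))"
      by (simp add: e'_def power2_eq_square algebra_simps)
    ultimately show ?thesis using \<rho> by simp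
  qed
  have "(u s - v s)\<^sup>2 \<le> (u t - v t)\<^sup>2"
    using exponential_growth[OF de e' st] by simp
  then show ?thesis by (simp add: abs_le_square_iff)
qed

text \<open>
  A gap \<open>u - v\<close> that starts positive never vanishes, since its absolute value is nondecreasing; so it
  keeps its sign, and the previous estimate holds without absolute values.
\<close>

lemma cooperative_gap_ordered:
  assumes sol1: "cooperative_solution T \<delta> \<rho> g q X u"
    and sol2: "cooperative_solution T \<delta> \<rho> g q Y v"
    and "mono g" "mono q" "0 \<le> \<rho>" "X 0 = Y 0" "0 \<le> T" "v 0 < u 0"
  shows "u 0 - v 0 \<le> u T - v T"
proof (rule ccontr)
  assume *: "\<not> ?thesis"
  have gap: "\<bar>u 0 - v 0\<bar> \<le> \<bar>u t - v t\<bar>" if "t \<in> {0..T}" for t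
    using cooperative_gap_nondecreasing[OF assms(1-6), of 0 t] that by simp
  have "continuous_on {0..T} (\<lambda>t. u t - v t)"
    using sol1 sol2 unfolding cooperative_solution_def
    by (intro continuous_on_diff)
       (meson DERIV_continuous continuous_on_eq_continuous_within)+
  moreover have "u T - v T \<le> 0" "0 \<le> u 0 - v 0"
    using * gap[of T] assms by auto
  ultimately obtain t where "t \<in> {0..T}" "u t - v t = 0"
    using IVT2'[of "\<lambda>t. u t - v t" T 0 0] \<open>0 \<le> T\<close> by auto
  then show False using gap[of t] * gap[of T] assms by auto
qed

section \<open>The two-point boundary value problem\<close>

text \<open>
  A gap \<open>u - v\<close> that is nondecreasing in absolute value and ends at \<open>0\<close> is always \<open>0\<close>; then
  \<open>X - Y\<close> solves \<open>d' = - \<delta> d\<close> with \<open>d 0 = 0\<close>.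
\<close>

lemma cooperative_boundary_unique:
  assumes sol1: "cooperative_solution T \<delta> \<rho> g q X u"
    and sol2: "cooperative_solution T \<delta> \<rho> g q Y v"
    and mono: "mono g" "mono q" "0 \<le> \<rho>" and init: "X 0 = Y 0" and fin: "u T = v T"
    and t: "t \<in> {0..T}"
  shows "X t = Y t" "u t = v t"
proof -
  have uv: "u \<tau> = v \<tau>" if "\<tau> \<in> {0..T}" for \<tau>
    using cooperative_gap_nondecreasing[OF sol1 sol2 mono init, of \<tau> T] that fin by simp
  then show "u t = v t" using t .
  have "((\<lambda>\<tau>. - ((X \<tau> - Y \<tau>)\<^sup>2)) has_real_derivative 2 * \<delta> * (X \<tau> - Y \<tau>)\<^sup>2) (at \<tau> within {0..T})"
    if "\<tau> \<in> {0..T}" for \<tau>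
    using sol1 sol2 that uv[OF that] unfolding cooperative_solution_def
    by (auto intro!: derivative_eq_intros simp: power2_eq_square algebra_simps)
  then have "- ((X 0 - Y 0)\<^sup>2) * exp (- 2 * \<delta> * (t - 0)) \<le> - ((X t - Y t)\<^sup>2)"
    by (rule exponential_growth) (use t in auto)
  then show "X t = Y t" using init by simp
qed

text \<open>
  Shooting: the terminal value \<open>u s T\<close> depends continuously on the initial value \<open>s\<close> of the second
  component and increases at least as fast as \<open>s\<close>, so it passes through \<open>b\<close>.
\<close>

lemma cooperative_boundary_exists:
  assumes T: "0 \<le> T" and g: "mono g" "M-lipschitz_on UNIV g"
    and q: "mono q" "N-lipschitz_on UNIV q" and \<rho>: "0 \<le> \<rho>"
  obtains X u where "cooperative_solution T \<delta> \<rho> g q X u" "X 0 = x0" "u T = b"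
proof -
  define F :: "real \<times> real \<Rightarrow> real \<times> real"
    where "F = (\<lambda>z. (g (snd z) - \<delta> * fst z, \<rho> * snd z + q (fst z)))"
  have "\<exists>L. L-lipschitz_on UNIV F"
  proof -
    have fst: "1-lipschitz_on UNIV (fst :: real \<times> real \<Rightarrow> real)"
      and snd: "1-lipschitz_on UNIV (snd :: real \<times> real \<Rightarrow> real)"
      by (rule lipschitz_onI; simp add: dist_fst_le dist_snd_le)+
    note comp = lipschitz_on_compose2[OF snd lipschitz_on_subset[OF g(2) subset_UNIV]]
      lipschitz_on_compose2[OF fst lipschitz_on_subset[OF q(2) subset_UNIV]]
    show ?thesis unfolding F_def
      by (rule exI) (rule lipschitz_on_Pair lipschitz_on_diff lipschitz_on_add comp
          lipschitz_on_cmult_real fst snd)+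
  qed
  then obtain L where lip: "L-lipschitz_on UNIV F" ..
  have "\<exists>y. y 0 = (x0, s) \<and>
      (\<forall>t\<in>{0..T}. (y has_vector_derivative F (y t)) (at t within {0..T}))" for s
    using global_picard_lindelof[OF lip T, of "(x0, s)"] by metis
  then obtain y where y0: "\<And>s. y s 0 = (x0, s)"
    and y: "\<And>s t. t \<in> {0..T} \<Longrightarrow> (y s has_vector_derivative F (y s t)) (at t within {0..T})"
    by metis
  define X where "X s t = fst (y s t)" for s t
  define u where "u s t = snd (y s t)" for s t
  have sol: "cooperative_solution T \<delta> \<rho> g q (X s) (u s)" for s
    unfolding cooperative_solution_def
  proof (intro conjI ballI)
    fix t assume t: "t \<in> {0..T}"
    show "(X s has_real_derivative g (u s t) - \<delta> * X s t) (at t within {0..T})"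
      using bounded_linear.has_vector_derivative[OF bounded_linear_fst y[OF t, of s]]
      by (simp add: has_real_derivative_iff_has_vector_derivative F_def X_def[abs_def] u_def)
    show "(u s has_real_derivative \<rho> * u s t + q (X s t)) (at t within {0..T})"
      using bounded_linear.has_vector_derivative[OF bounded_linear_snd y[OF t, of s]]
      by (simp add: has_real_derivative_iff_has_vector_derivative F_def X_def u_def[abs_def])
  qed
  have init: "X s 0 = x0" "u s 0 = s" for s by (simp_all add: X_def u_def y0)
  have expand: "s' - s \<le> u s' T - u s T" if "s \<le> s'" for s s'
    using cooperative_gap_ordered[OF sol[of s'] sol[of s] g(1) q(1) \<rho>] that T
    by (cases "s = s'") (auto simp: init)
  have "(exp (L * T))-lipschitz_on UNIV (\<lambda>s. u s T)"
  proof (rule lipschitz_onI)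
    fix s s' :: real
    have "dist (u s T) (u s' T) \<le> dist (y s T) (y s' T)"
      unfolding u_def by (rule dist_snd_le)
    also have "\<dots> \<le> exp (L * T) * dist (y s 0) (y s' 0)"
      unfolding dist_norm by (rule lipschitz_dependence_on_initial_value[OF lip T y y])
    finally show "dist (u s T) (u s' T) \<le> exp (L * T) * dist s s'"
      by (simp add: y0 dist_Pair_Pair)
  qed simp
  then have cont: "continuous_on A (\<lambda>s. u s T)" for A
    by (meson lipschitz_on_continuous_on continuous_on_subset subset_UNIV)
  \<comment> \<open>The miss distance of the shot from \<open>0\<close> bounds how far its initial value has to be moved.\<close>
  define R where "R = \<bar>b - u 0 T\<bar>"
  have "u (- R) T \<le> b" "b \<le> u R T"
    using expand[of "- R" 0] expand[of 0 R] by (auto simp: R_def)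
  then obtain s where "u s T = b"
    using IVT'[of "\<lambda>s. u s T" "- R" b R] cont by (auto simp: R_def)
  then show ?thesis using that sol init by blast
qed

section \<open>The forward-backward system\<close>

theorem proposition3p1:
  fixes T \<delta> r \<alpha> \<beta> c h X0 :: real and P :: "real \<Rightarrow> real"
  assumes "T > 0" and "\<delta> > 0" and "r > 0" and "\<alpha> > 0" and "\<beta> > 0" and "c > 0"
    and "h \<in> {0..8760}"
    and "X0 \<ge> 0"
    and "strict_antimono_on {0..} P"
    and "\<exists>L. L-lipschitz_on {0..} P"
  shows "\<exists>X u. fb_solution T \<delta> r \<alpha> \<beta> c h P X0 X u \<and>
           (\<forall>X' u'. fb_solution T \<delta> r \<alpha> \<beta> c h P X0 X' u' \<longrightarrow>
              (\<forall>t\<in>{0..T}. X' t = X t \<and> u' t = u t))"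
proof -
  define g where "g v = 1 / \<beta> * max (v - \<alpha>) 0" for v
  \<comment> \<open>Composing \<open>P\<close> with \<open>max x 0\<close> carries monotonicity and the Lipschitz bound over to the whole line.\<close>
  define q where "q x = - ((P (max x 0) - c) * h)" for x
  have mono_g: "mono g"
    using \<open>\<beta> > 0\<close> by (auto intro!: monoI divide_right_mono simp: g_def)
  have mono_q: "mono q"
  proof (rule monoI)
    fix x y :: real assume "x \<le> y"
    then consider "max x 0 = max y 0" | "max x 0 < max y 0" by linarith
    then have "P (max y 0) \<le> P (max x 0)"
    proof cases
      case 2
      then have "P (max y 0) < P (max x 0)"
        by (intro monotone_onD[OF \<open>strict_antimono_on {0..} P\<close>]) simp_all
      then show ?thesis by simp
    qed simp
    then show "q x \<le> q y"
      using \<open>h \<in> {0..8760}\<close> by (auto simp: q_def intro!: mult_right_mono)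
  qed
  have lip_g: "(1 / \<beta>)-lipschitz_on UNIV g"
  proof (rule lipschitz_onI)
    fix v w :: real
    have "dist (g v) (g w) = 1 / \<beta> * \<bar>max (v - \<alpha>) 0 - max (w - \<alpha>) 0\<bar>"
      using \<open>\<beta> > 0\<close> by (simp add: g_def dist_real_def abs_mult flip: diff_divide_distrib)
    also have "\<dots> \<le> 1 / \<beta> * \<bar>v - w\<bar>"
      using \<open>\<beta> > 0\<close> by (intro mult_left_mono) auto
    finally show "dist (g v) (g w) \<le> 1 / \<beta> * dist v w" by (simp add: dist_real_def)
  qed (use \<open>\<beta> > 0\<close> in simp)
  obtain L where L: "L-lipschitz_on {0..} P" using assms(10) ..
  have lip_q: "(h * L)-lipschitz_on UNIV q"
  proof (rule lipschitz_onI)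
    fix x y :: real
    have "dist (q x) (q y) = h * \<bar>P (max x 0) - P (max y 0)\<bar>"
    proof -
      have "q x - q y = h * (P (max y 0) - P (max x 0))" by (simp add: q_def algebra_simps)
      then show ?thesis using \<open>h \<in> {0..8760}\<close> by (simp add: dist_real_def abs_mult abs_minus_commute)
    qed
    also have "\<dots> \<le> h * (L * \<bar>max x 0 - max y 0\<bar>)"
      using \<open>h \<in> {0..8760}\<close> lipschitz_onD[OF L, of "max x 0" "max y 0"]
      by (intro mult_left_mono) (auto simp: dist_real_def)
    also have "\<dots> \<le> h * (L * \<bar>x - y\<bar>)"
      using \<open>h \<in> {0..8760}\<close> lipschitz_on_nonneg[OF L] by (intro mult_left_mono) auto
    finally show "dist (q x) (q y) \<le> h * L * dist x y" by (simp add: dist_real_def)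
  qed (use \<open>h \<in> {0..8760}\<close> lipschitz_on_nonneg[OF L] in simp)
  have \<rho>: "0 \<le> r + \<delta>" using assms by simp
  obtain X u where sol: "cooperative_solution T \<delta> (r + \<delta>) g q X u" and bc: "X 0 = X0" "u T = 0"
    using cooperative_boundary_exists[OF _ mono_g lip_g mono_q lip_q \<rho>] \<open>T > 0\<close> by (metis less_imp_le)
  have dX: "(X has_real_derivative g (u t) - \<delta> * X t) (at t within {0..T})"
    and du: "(u has_real_derivative (r + \<delta>) * u t + q (X t)) (at t within {0..T})"
    if "t \<in> {0..T}" for t
    using sol that by (auto simp: cooperative_solution_def)
  \<comment> \<open>On nonnegative \<open>X\<close>, the extended system is the given one.\<close>
  have X_nonneg: "0 \<le> X t" if "t \<in> {0..T}" for t
  proof -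
    have "X 0 * exp (- \<delta> * (t - 0)) \<le> X t"
      by (rule exponential_growth[OF dX]) (use that \<open>\<beta> > 0\<close> in \<open>auto simp: g_def\<close>)
    then show ?thesis using bc \<open>X0 \<ge> 0\<close> by (smt (verit) exp_gt_zero mult_nonneg_nonneg)
  qed
  have cont: "continuous_on {0..T} X" "continuous_on {0..T} u"
    using dX du by (meson DERIV_continuous continuous_on_eq_continuous_within)+
  have cont_gq: "continuous_on UNIV g" "continuous_on UNIV q"
    using lip_g lip_q by (auto intro: lipschitz_on_continuous_on)
  have "C1_on_interval 0 T X"
    unfolding C1_on_interval_def using dX cont
    by (intro exI[of _ "\<lambda>t. g (u t) - \<delta> * X t"] conjI ballI continuous_intros
        continuous_on_compose2[OF cont_gq(1)]) auto
  moreover have "C1_on_interval 0 T u"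
    unfolding C1_on_interval_def using du cont
    by (intro exI[of _ "\<lambda>t. (r + \<delta>) * u t + q (X t)"] conjI ballI continuous_intros
        continuous_on_compose2[OF cont_gq(2)]) auto
  ultimately
  have "fb_solution T \<delta> r \<alpha> \<beta> c h P X0 X u"
    unfolding fb_solution_def using X_nonneg bc dX du
    by (auto simp: g_def q_def max_absorb1)
  moreover have "X' t = X t" "u' t = u t"
    if sol': "fb_solution T \<delta> r \<alpha> \<beta> c h P X0 X' u'" and t: "t \<in> {0..T}" for X' u' t
  proof -
    have "cooperative_solution T \<delta> (r + \<delta>) g q X' u'"
      using sol' by (auto simp: fb_solution_def cooperative_solution_def g_def q_def max_absorb1)
    moreover have "X' 0 = X 0" "u' T = u T"
      using sol' bc by (auto simp: fb_solution_def)
    ultimately show "X' t = X t" "u' t = u t"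
      using cooperative_boundary_unique[OF _ sol mono_g mono_q \<rho> _ _ t] by blast+
  qed
  ultimately show ?thesis by blast
qed

end
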